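(* For every $\Lambda\in[2,\infty)$ there exists a closed finite-codimensional subspace $Y$ of the real Banach space $C[0,1]$ such that \[ \lambda(Y,C[0,1])=\Lambda, \] and the infimum defining $\lambda(Y,C[0,1])$ is not attained.
   Context: $C[0,1]$ is the real Banach space of continuous real-valued functions on $[0,1]$ with the supremum norm. For a closed subspace $E$ of a Banach space $F$, the projection constant of $E$ in $F$ is $\lambda(E,F)=\inf\{\|P\| : P\colon F\to E \text{ bounded linear},\ P|_E=\mathrm{Id}_E\}$. *)

theory Defs
  imports "HOL-Analysis.Analysis"
begin

text \<open>
  The interval \<open>[0,1]\<close> is made a metric space of its own, so that the library type of bounded
  continuous functions over it, with its supremum norm, is the Banach space \<open>C[0,1]\<close>;
  boundedness is no restriction by compactness (see below).
\<close>

typedef unit_interval = "{0..1::real}"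
  by auto

instantiation unit_interval :: metric_space
begin

definition dist_unit_interval :: "unit_interval \<Rightarrow> unit_interval \<Rightarrow> real" where
  "dist_unit_interval s t = dist (Rep_unit_interval s) (Rep_unit_interval t)"

definition uniformity_unit_interval :: "(unit_interval \<times> unit_interval) filter" where
  "uniformity_unit_interval = (INF e\<in>{0<..}. principal {(s, t). dist s t < e})"

definition open_unit_interval :: "unit_interval set \<Rightarrow> bool" where
  "open_unit_interval U \<longleftrightarrow> (\<forall>s\<in>U. eventually (\<lambda>(s', t). s' = s \<longrightarrow> t \<in> U) uniformity)"

instance
  by standard
    (auto simp: dist_unit_interval_def uniformity_unit_interval_def open_unit_interval_def
      Rep_unit_interval_inject dist_triangle2)

end

lemma continuous_on_Abs_unit_interval: "continuous_on {0..1} Abs_unit_interval"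
  by (auto simp: continuous_on_iff dist_unit_interval_def Abs_unit_interval_inverse)

lemma compact_UNIV_unit_interval: "compact (UNIV :: unit_interval set)"
proof -
  have "Abs_unit_interval ` {0..1} = UNIV"
    using type_definition.Abs_image[OF type_definition_unit_interval] .
  then show ?thesis
    using compact_continuous_image[OF continuous_on_Abs_unit_interval compact_Icc] by simp
qed

type_synonym C01 = "unit_interval \<Rightarrow>\<^sub>C real"

lemma bcontfun_unit_interval_iff:
  fixes f :: "unit_interval \<Rightarrow> real"
  shows "f \<in> bcontfun \<longleftrightarrow> continuous_on UNIV f"
  using compact_imp_bounded[OF compact_continuous_image[OF _ compact_UNIV_unit_interval, of f]]
  by (auto simp: bcontfun_def)

text \<open>The quotient by \<open>Y\<close> is spanned by the cosets of finitely many vectors.\<close>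

definition finite_codimensional :: "'a::real_vector set \<Rightarrow> bool" where
  "finite_codimensional Y \<longleftrightarrow> subspace Y \<and> (\<exists>B. finite B \<and> (\<forall>x. \<exists>b\<in>span B. x - b \<in> Y))"

definition projections_onto :: "'a::real_normed_vector set \<Rightarrow> ('a \<Rightarrow>\<^sub>L 'a) set" where
  "projections_onto E =
    {P. range (blinfun_apply P) \<subseteq> E \<and> (\<forall>x\<in>E. blinfun_apply P x = x)}"

text \<open>
  The ambient space \<open>F\<close> is the whole type \<^typ>\<open>'a\<close>. The infimum is taken in the extended reals,
  so that it is \<open>\<infinity>\<close> when \<open>E\<close> is not complemented.
\<close>

definition projection_constant :: "'a::real_normed_vector set \<Rightarrow> ereal" where
  "projection_constant E = (INF P\<in>projections_onto E. ereal (norm P))"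

definition projection_constant_attained :: "'a::real_normed_vector set \<Rightarrow> bool" where
  "projection_constant_attained E \<longleftrightarrow>
    (\<exists>P\<in>projections_onto E. ereal (norm P) = projection_constant E)"

end

theory Submission
  imports Defs
begin

text \<open>
  Let \<open>\<phi>\<^sub>b\<close> (\<open>b < M\<close>) be disjointly supported, purely atomic measures of norm one on \<open>[0,1]\<close>. Given
  vectors \<open>x\<^sub>b \<in> \<real>\<^sup>n\<close>, let \<open>Y\<close> be the common kernel of the \<open>n\<close> measures \<open>m\<^sub>i = \<Sum>\<^sub>b x\<^sub>b(i) \<phi>\<^sub>b\<close>. A projection \<open>P\<close>
  onto \<open>Y\<close> has the form \<open>P f = f - \<Sum>\<^sub>i m\<^sub>i(f) F\<^sub>i\<close> with \<open>m\<^sub>j(F\<^sub>i) = \<delta>\<^sub>i\<^sub>j\<close>, that is, it is given by a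
  continuous curve \<open>F\<close> in \<open>\<real>\<^sup>n\<close>. Put \<open>N(a) = \<parallel>\<Sum>\<^sub>i a\<^sub>i m\<^sub>i\<parallel> = \<Sum>\<^sub>b \<bar>\<langle>a, x\<^sub>b\<rangle>\<bar>\<close>. Away from the countably many atoms a
  test function may take the value \<open>1\<close> at \<open>t\<close> and still nearly norm every \<open>\<phi>\<^sub>b\<close> with prescribed signs;
  this is the Daugavet phenomenon, and it gives \<open>\<parallel>P\<parallel> = 1 + sup\<^sub>t N(F(t))\<close>. Hence
  \<open>\<lambda>(Y, C[0,1]) - 1\<close> is the least possible size of \<open>sup N(F)\<close>, the projection constant in
  \<open>\<ell>\<^sub>1\<^sup>M\<close> of the span of the \<open>n\<close> sequences \<open>b \<mapsto> x\<^sub>b(i)\<close>.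

  That constant is found by trace duality. If \<open>\<Sum>\<^sub>b y\<^sub>b \<otimes> x\<^sub>b\<close> is the identity and \<open>N(y\<^sub>b) \<le> \<rho>\<close>, then curves
  \<open>F = \<Sum>\<^sub>b f\<^sub>b y\<^sub>b\<close> with disjointly supported \<open>f\<^sub>b\<close> come as close to \<open>\<rho>\<close> as desired
  (\<open>projection_with_norm_near\<close>). If \<open>\<bar>\<langle>a, x\<^sub>b\<rangle>\<bar> \<le> w\<^sub>b N(a)\<close> and \<open>\<rho> \<Sum>\<^sub>b w\<^sub>b = n\<close>, then
  \<open>n = \<Sum>\<^sub>i m\<^sub>i(F\<^sub>i) = \<Sum>\<^sub>b \<phi>\<^sub>b(\<langle>F, x\<^sub>b\<rangle>) \<le> sup N(F) \<Sum>\<^sub>b w\<^sub>b\<close> shows that \<open>\<rho>\<close> is a lower bound. The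
  infimum is not attained, because the signs of the atoms of \<open>\<phi>\<^sub>b\<close> alternate along a convergent
  sequence: no nonzero continuous function norms \<open>\<phi>\<^sub>b\<close>, and the inequality is strict
  (\<open>trace_less\<close>).

  It remains to realize every \<open>\<rho> = \<Lambda> - 1 \<ge> 1\<close>. Take \<open>n = 2\<^sup>k\<close>, a symmetric Hadamard matrix with rows
  \<open>h\<^sub>1, \<dots>, h\<^sub>n\<close> and a weight \<open>s \<ge> 0\<close>, and let the \<open>x\<^sub>b\<close> be the vectors \<open>h\<^sub>j / n\<close> and \<open>(s / n) e\<^sub>i\<close>. The
  two certificates match when \<open>1 / \<rho> = 1 / (1 + s) + s / (n + s)\<close>. The right-hand side is \<open>1\<close> at
  \<open>s = 0\<close> and \<open>2 / (1 + \<surd>n)\<close> at \<open>s = \<surd>n\<close>, so for large \<open>n\<close> the intermediate value theorem supplies \<open>s\<close>.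
\<close>

section \<open>Norm-one functionals that do not attain their norm\<close>

lemma bcontfun_of_real_function:
  fixes g :: "real \<Rightarrow> real"
  assumes "continuous_on UNIV g"
  obtains G :: C01 where "\<And>t. apply_bcontfun G t = g (Rep_unit_interval t)"
proof -
  have "continuous_on UNIV Rep_unit_interval"
    by (auto simp: continuous_on_iff dist_unit_interval_def)
  then have "continuous_on UNIV (\<lambda>t. g (Rep_unit_interval t))"
    by (intro continuous_on_compose2[OF assms]) auto
  then have "(\<lambda>t. g (Rep_unit_interval t)) \<in> bcontfun"
    by (simp add: bcontfun_unit_interval_iff)
  then show thesis
    using that[of "Bcontfun (\<lambda>t. g (Rep_unit_interval t))"] by (simp add: Bcontfun_inverse)
qed

text \<open>
  The block of atoms with index \<open>b\<close> decreases to \<open>b / M\<close>. In the coordinate \<open>4 M t\<close> it lies in the interval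
  from \<open>4 b\<close> to \<open>4 b + 1\<close>, so tents of radius \<open>2\<close> around the points \<open>4 b\<close> have disjoint interiors and
  separate the blocks. The point \<open>0\<close> is never an atom.
\<close>

definition atom :: "nat \<Rightarrow> nat \<Rightarrow> nat \<Rightarrow> unit_interval" where
  "atom M b k = Abs_unit_interval ((4 * real b + 1 / real (k + 1)) / (4 * real M))"

definition alternating :: "nat \<Rightarrow> nat \<Rightarrow> C01 \<Rightarrow> real" where
  "alternating M b f = (\<Sum>k. (1/2) ^ Suc k * ((-1) ^ k * apply_bcontfun f (atom M b k)))"

lemma Rep_atom:
  assumes "b < M"
  shows "Rep_unit_interval (atom M b k) = (4 * real b + 1 / real (k + 1)) / (4 * real M)"
proof -
  have "1 / real (k + 1) \<le> 1" "real b + 1 \<le> real M"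
    using assms by (auto simp: field_simps)
  then have "4 * real b + 1 / real (k + 1) \<le> 4 * real M" by linarith
  then show ?thesis
    using assms unfolding atom_def by (intro Abs_unit_interval_inverse) (simp add: divide_le_eq del: of_nat_add)
qed

lemma atom_inject:
  assumes "b < M" "c < M" "atom M b k = atom M c l"
  shows "b = c \<and> k = l"
proof -
  have "(4 * real b + 1 / real (k + 1)) / (4 * real M) = (4 * real c + 1 / real (l + 1)) / (4 * real M)"
    unfolding Rep_atom[OF assms(1), symmetric] Rep_atom[OF assms(2), symmetric] assms(3) ..
  then have eq: "4 * real b + 1 / real (k + 1) = 4 * real c + 1 / real (l + 1)"
    unfolding divide_cancel_right using assms(1) by simp
  have "0 < 1 / real (k + 1)" "1 / real (k + 1) \<le> 1" "0 < 1 / real (l + 1)" "1 / real (l + 1) \<le> 1"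
    by (auto simp: field_simps)
  then have "b = c"
    using eq by linarith
  then show ?thesis
    using eq by (simp del: of_nat_add)
qed

lemma atom_tendsto:
  assumes "b < M"
  shows "atom M b \<longlonglongrightarrow> Abs_unit_interval (real b / real M)"
proof -
  have lim: "(\<lambda>k. (4 * real b + 1 / real (k + 1)) / (4 * real M)) \<longlonglongrightarrow> (4 * real b + 0) / (4 * real M)"
    using LIMSEQ_inverse_real_of_nat
    by (intro tendsto_intros) (use assms in \<open>auto simp: inverse_eq_divide\<close>)
  have range: "(4 * real b + 1 / real (k + 1)) / (4 * real M) \<in> {0..1}" for k
    using Rep_unit_interval[of "atom M b k"] Rep_atom[OF assms] by simp
  have "(\<lambda>k. Abs_unit_interval ((4 * real b + 1 / real (k + 1)) / (4 * real M)))
      \<longlonglongrightarrow> Abs_unit_interval ((4 * real b + 0) / (4 * real M))"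
    by (rule continuous_on_tendsto_compose[OF continuous_on_Abs_unit_interval lim])
      (use range assms in \<open>auto simp: field_simps simp del: of_nat_add\<close>)
  then show ?thesis
    by (simp add: atom_def[abs_def])
qed

text \<open>
  There are only countably many atoms, while every neighbourhood in \<open>[0,1]\<close> is uncountable.
\<close>

lemma nonatom_near:
  assumes "e > 0"
  obtains u where "dist u t < e" "u \<notin> {atom M b k |b k. b < M}"
proof -
  define r where "r = Rep_unit_interval t"
  have r: "0 \<le> r" "r \<le> 1" using Rep_unit_interval[of t] by (auto simp: r_def)
  define J where "J = {max 0 (r - e/2)..min 1 (r + e/2)}"
  have "{atom M b k |b k. b < M} \<subseteq> range (\<lambda>(b, k). atom M b k)" by auto
  then have "countable (Rep_unit_interval ` {atom M b k |b k. b < M})"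
    by (meson countable_image countable_subset countableI_type)
  moreover have "uncountable J"
    unfolding J_def uncountable_closed_interval using r assms by auto
  ultimately obtain v where v: "v \<in> J" "v \<notin> Rep_unit_interval ` {atom M b k |b k. b < M}"
    by (meson countable_subset subsetI)
  have vr: "Rep_unit_interval (Abs_unit_interval v) = v"
    using v(1) by (intro Abs_unit_interval_inverse) (auto simp: J_def)
  show thesis
  proof (rule that)
    show "dist (Abs_unit_interval v) t < e"
      unfolding dist_unit_interval_def vr r_def[symmetric] dist_real_def
      using v(1) assms by (simp add: J_def abs_less_iff; linarith)
    show "Abs_unit_interval v \<notin> {atom M b k |b k. b < M}"
    proof
      assume "Abs_unit_interval v \<in> {atom M b k |b k. b < M}"
      from imageI[OF this, of Rep_unit_interval] v(2) show False unfolding vr by (rule notE[rotated])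
    qed
  qed
qed

lemma le_of_le_off_atoms:
  fixes h :: "unit_interval \<Rightarrow> real"
  assumes "continuous_on UNIV h"
    and "\<And>u. u \<notin> {atom M b k |b k. b < M} \<Longrightarrow> h u \<le> B"
  shows "h t \<le> B"
proof -
  have "t \<in> closure (- {atom M b k |b k. b < M})"
    unfolding closure_approachable
  proof (intro allI impI)
    fix e :: real assume "0 < e"
    then obtain u where "dist u t < e" "u \<notin> {atom M b k |b k. b < M}"
      by (rule nonatom_near)
    then show "\<exists>u\<in>- {atom M b k |b k. b < M}. dist u t < e"
      by (intro bexI[of _ u]) simp_all
  qed
  with continuous_on_subset[OF assms(1) subset_UNIV] show ?thesis
    by (rule continuous_le_on_closure) (use assms(2) in auto)
qed

lemma alternating_summable:
  "summable (\<lambda>k. (1/2) ^ Suc k * ((-1) ^ k * apply_bcontfun (f :: C01) (atom M b k)))"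
proof (rule summable_comparison_test')
  show "summable (\<lambda>k. (1/2) ^ Suc k * norm f)"
    by (intro summable_mult2 sums_summable[OF power_half_series])
  show "norm ((1/2) ^ Suc k * ((-1) ^ k * apply_bcontfun f (atom M b k))) \<le> (1/2) ^ Suc k * norm f" for k
    using norm_bounded[of f "atom M b k"] by (simp add: abs_mult power_abs)
qed

lemma alternating_bound:
  assumes "\<And>t. \<bar>apply_bcontfun f t\<bar> \<le> B"
  shows "\<bar>alternating M b f\<bar> \<le> B"
proof -
  have "(\<lambda>k. (1/2) ^ Suc k * B) sums (1 * B)"
    by (intro sums_mult2 power_half_series)
  moreover have "norm (alternating M b f) \<le> (\<Sum>k. (1/2) ^ Suc k * B)"
    unfolding alternating_def
    using calculation
    by (intro norm_suminf_le) (auto simp: sums_iff abs_mult power_abs assms)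
  ultimately show ?thesis by (simp add: sums_iff)
qed

lemma bounded_linear_alternating: "bounded_linear (alternating M b)"
proof
  show "alternating M b (f + g) = alternating M b f + alternating M b g" for f g
    unfolding alternating_def
    by (subst suminf_add[OF alternating_summable alternating_summable]) (simp add: distrib_left)
  show "alternating M b (r *\<^sub>R f) = r *\<^sub>R alternating M b f" for r f
    unfolding alternating_def real_scaleR_def
    by (subst suminf_mult[OF alternating_summable, symmetric]) (simp add: mult_ac)
  show "\<exists>K. \<forall>f. norm (alternating M b f) \<le> norm f * K"
  proof (intro exI allI)
    show "norm (alternating M b f) \<le> norm f * 1" for f
      using alternating_bound[of f "norm f"] norm_bounded[of f] by simp
  qed
qed

text \<open>
  Equality would force \<open>f\<close> to take the values \<open>B\<close> and \<open>-B\<close> alternately on a convergent sequence of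
  atoms, against continuity at the limit. This is the source of the strict inequality for the norm
  of every projection.
\<close>

lemma alternating_less:
  assumes "b < M" and B: "\<And>t. \<bar>apply_bcontfun f t\<bar> \<le> B" and "0 < B"
  shows "alternating M b f < B"
proof (rule ccontr)
  let ?d = "\<lambda>k. (1/2) ^ Suc k * (B - (-1) ^ k * apply_bcontfun f (atom M b k))"
  assume "\<not> alternating M b f < B"
  then have ge: "B \<le> alternating M b f" by simp
  have "?d sums (1 * B - alternating M b f)"
    unfolding alternating_def right_diff_distrib
    by (intro sums_diff sums_mult2 power_half_series summable_sums alternating_summable)
  moreover have nonneg: "0 \<le> ?d k" for k
  proof -
    have "(-1) ^ k * apply_bcontfun f (atom M b k) \<le> B"
      using B[of "atom M b k"] by (cases "even k") auto
    then show ?thesis by simp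
  qed
  ultimately have "?d k \<le> 0" for k
    using sum_le_suminf[of ?d "{k}"] ge by (auto simp: sums_iff)
  then have "?d k = 0" for k
    using nonneg by (rule order_antisym)
  then have alt: "(-1) ^ k * apply_bcontfun f (atom M b k) = B" for k
    by (simp del: power_Suc)
  have lim: "(\<lambda>k. apply_bcontfun f (atom M b k)) \<longlonglongrightarrow> apply_bcontfun f (Abs_unit_interval (real b / real M))"
    by (rule continuous_on_tendsto_compose[OF continuous_on_apply_bcontfun[of UNIV] atom_tendsto[OF assms(1)]]) auto
  have "(\<lambda>k. apply_bcontfun f (atom M b (2 * k))) \<longlonglongrightarrow> apply_bcontfun f (Abs_unit_interval (real b / real M))"
    using LIMSEQ_subseq_LIMSEQ[OF lim, of "\<lambda>k. 2 * k"] by (simp add: o_def strict_mono_def)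
  moreover have even: "apply_bcontfun f (atom M b (2 * k)) = B" for k
    using alt[of "2 * k"] by simp
  ultimately have 1: "apply_bcontfun f (Abs_unit_interval (real b / real M)) = B"
    unfolding even LIMSEQ_const_iff by simp
  have "(\<lambda>k. apply_bcontfun f (atom M b (2 * k + 1))) \<longlonglongrightarrow> apply_bcontfun f (Abs_unit_interval (real b / real M))"
    using LIMSEQ_subseq_LIMSEQ[OF lim, of "\<lambda>k. 2 * k + 1"] by (simp add: o_def strict_mono_def)
  moreover have odd: "apply_bcontfun f (atom M b (2 * k + 1)) = - B" for k
    using alt[of "2 * k + 1"] by simp
  ultimately have "apply_bcontfun f (Abs_unit_interval (real b / real M)) = - B"
    unfolding odd LIMSEQ_const_iff by simp
  with 1 \<open>0 < B\<close> show False by simp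
qed

text \<open>
  The Daugavet property of \<open>C[0,1]\<close> for the span of these functionals: the value at \<open>t\<close> can be
  prescribed independently of the functionals. By Tietze's theorem it suffices to prescribe values
  at \<open>t\<close> and at finitely many atoms of each block, since the tails of the series are small; this is
  consistent because \<open>t\<close> is not an atom.
\<close>

lemma alternating_near_norming:
  fixes \<sigma> :: "nat \<Rightarrow> real"
  assumes t: "t \<notin> {atom M b k |b k. b < M}" and \<sigma>: "\<And>b. \<bar>\<sigma> b\<bar> = 1" and "0 < \<epsilon>"
  obtains g :: C01 where "\<And>u. \<bar>apply_bcontfun g u\<bar> \<le> 1" "apply_bcontfun g t = 1"
    "\<And>b. b < M \<Longrightarrow> 1 - \<epsilon> \<le> \<sigma> b * alternating M b g"
proof -
  obtain K where K: "(1/2 :: real) ^ K < \<epsilon> / 2"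
    using real_arch_pow_inv[of "\<epsilon>/2" "1/2"] \<open>0 < \<epsilon>\<close> by auto
  define p where "p = (\<lambda>(b, k). atom M b k)"
  define D where "D = {..<M} \<times> {..<K}"
  have inj: "inj_on p D"
    by (auto simp: inj_on_def p_def D_def dest: atom_inject)
  \<comment> \<open>the values to be interpolated, with the sign pattern of each block at its first \<open>K\<close> atoms\<close>
  define v where "v = (\<lambda>u. if u = t then 1 else (\<lambda>(b, k). \<sigma> b * (-1) ^ k) (inv_into D p u))"
  have v_atom: "v (atom M b k) = \<sigma> b * (-1) ^ k" if "b < M" "k < K" for b k
  proof -
    have "inv_into D p (p (b, k)) = (b, k)"
      using that by (intro inv_into_f_f[OF inj]) (auto simp: D_def)
    moreover have "atom M b k \<noteq> t" using t that by auto
    ultimately show ?thesis by (simp add: v_def p_def)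
  qed
  define S where "S = Rep_unit_interval ` insert t (p ` D)"
  have "finite S" by (simp add: S_def D_def)
  then obtain g where g: "continuous_on UNIV g"
    "\<And>r. r \<in> S \<Longrightarrow> g r = v (Abs_unit_interval r)" "\<And>r. norm (g r) \<le> 1"
  proof (rule_tac Tietze[of S "\<lambda>r. v (Abs_unit_interval r)" UNIV 1])
    show "norm (v (Abs_unit_interval r)) \<le> 1" for r
      by (auto simp: v_def abs_mult power_abs \<sigma> split: prod.split)
  qed (auto simp: finite_imp_closed continuous_on_finite)
  obtain G :: C01 where G: "\<And>u. apply_bcontfun G u = g (Rep_unit_interval u)"
    using bcontfun_of_real_function[OF g(1)] by blast
  show thesis
  proof (rule that)
    show bd: "\<bar>apply_bcontfun G u\<bar> \<le> 1" for u
      using g(3) by (simp add: G)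
    show "apply_bcontfun G t = 1"
      by (simp add: G g(2) S_def Rep_unit_interval_inverse v_def)
    fix b assume b: "b < M"
    let ?a = "\<lambda>k. (1/2) ^ Suc k * ((-1) ^ k * apply_bcontfun G (atom M b k))"
    \<comment> \<open>a lower bound of the series that keeps the first \<open>K\<close> terms and takes the worst sign after them\<close>
    let ?l = "\<lambda>k. 2 * (if k \<in> {..<K} then (1/2) ^ Suc k else 0) - (1/2 :: real) ^ Suc k"
    have "?l sums (2 * (\<Sum>k<K. (1/2) ^ Suc k) - 1)"
      by (intro sums_diff sums_mult sums_If_finite_set power_half_series) auto
    moreover have "(\<lambda>k. \<sigma> b * ?a k) sums (\<sigma> b * alternating M b G)"
      unfolding alternating_def by (intro sums_mult summable_sums alternating_summable)
    moreover have "?l k \<le> \<sigma> b * ?a k" for k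
    proof (cases "k < K")
      case True
      then have "Rep_unit_interval (atom M b k) \<in> S"
        using b by (force simp: S_def p_def D_def)
      then have "apply_bcontfun G (atom M b k) = \<sigma> b * (-1) ^ k"
        using b True v_atom by (simp add: G g(2) Rep_unit_interval_inverse)
      moreover have "\<sigma> b * \<sigma> b = 1"
        using \<sigma>[of b] by (metis abs_mult_self_eq mult_1)
      moreover have "\<sigma> b * ((1/2) ^ Suc k * ((-1) ^ k * (\<sigma> b * (-1) ^ k)))
          = (1/2) ^ Suc k * (\<sigma> b * \<sigma> b) * ((-1) ^ k * (-1) ^ k)"
        by (simp only: mult_ac)
      moreover have "(-1::real) ^ k * (-1) ^ k = 1"
        by (simp flip: power_mult_distrib)
      ultimately show ?thesis using True by simp
    next
      case False
      have "\<bar>\<sigma> b * ?a k\<bar> \<le> (1/2) ^ Suc k * 1"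
        using bd[of "atom M b k"] by (simp add: abs_mult \<sigma> power_abs)
      then show ?thesis using False by auto
    qed
    ultimately have "2 * (\<Sum>k<K. (1/2) ^ Suc k) - 1 \<le> \<sigma> b * alternating M b G"
      by (rule sums_le[rotated])
    moreover have "(\<Sum>k<K. (1/2 :: real) ^ Suc k) = 1 - (1/2) ^ K"
      by (induction K) auto
    ultimately show "1 - \<epsilon> \<le> \<sigma> b * alternating M b G"
      using K by simp
  qed
qed

text \<open>
  One function nearly norms all functionals at once; cutting it into pieces with disjoint supports
  costs nothing, because each functional sees only one block. The normalization that makes the
  system biorthogonal accounts for the factor \<open>1 / (1 - \<epsilon>)\<close>.
\<close>

lemma disjoint_biorthogonal_functions:
  assumes "0 < \<epsilon>" "\<epsilon> < 1"
  obtains f :: "nat \<Rightarrow> C01" where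
    "\<And>b c. b < M \<Longrightarrow> c < M \<Longrightarrow> alternating M c (f b) = (if b = c then 1 else 0)"
    "\<And>t. (\<Sum>b<M. \<bar>apply_bcontfun (f b) t\<bar>) \<le> 1 / (1 - \<epsilon>)"
proof -
  have "Abs_unit_interval 0 \<noteq> atom M b k" if "b < M" for b k
  proof
    assume "Abs_unit_interval 0 = atom M b k"
    then have "(4 * real b + 1 / real (k + 1)) / (4 * real M) = 0"
      using Rep_atom[OF that, of k] Abs_unit_interval_inverse[of 0] by (simp del: of_nat_add)
    moreover have "0 < (4 * real b + 1 / real (k + 1)) / (4 * real M)"
      using that by (intro divide_pos_pos add_nonneg_pos) auto
    ultimately show False by linarith
  qed
  then have "Abs_unit_interval 0 \<notin> {atom M b k |b k. b < M}"
    by blast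
  then obtain g :: C01 where g: "\<And>u. \<bar>apply_bcontfun g u\<bar> \<le> 1"
    "\<And>b. b < M \<Longrightarrow> 1 - \<epsilon> \<le> 1 * alternating M b g"
    using assms(1) by (rule_tac alternating_near_norming[where \<sigma> = "\<lambda>_. 1" and \<epsilon> = \<epsilon>])
      (assumption, rule abs_one, assumption, blast)
  define tent where "tent = (\<lambda>b r. max 0 (min 1 (2 - \<bar>4 * real M * r - 4 * real b\<bar>)))"
  have tent_cont: "continuous_on UNIV (tent b)" for b
    unfolding tent_def by (intro continuous_intros)
  have tent_atom: "tent b (Rep_unit_interval (atom M c k)) = (if b = c then 1 else 0)"
    if "c < M" for b c k
  proof -
    have y: "4 * real M * Rep_unit_interval (atom M c k) = 4 * real c + 1 / real (k + 1)"
      using that by (simp add: Rep_atom del: of_nat_add)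
    have "0 < 1 / real (k + 1)" "1 / real (k + 1) \<le> 1"
      by (auto simp: field_simps)
    moreover from this have "2 \<le> \<bar>4 * real c + 1 / real (k + 1) - 4 * real b\<bar>" if "b \<noteq> c"
      using that by linarith
    ultimately show ?thesis
      unfolding tent_def y by (auto simp del: of_nat_add)
  qed
  have tent_sum: "(\<Sum>b<M. tent b r) \<le> 1" for r
  proof (cases "\<exists>b<M. tent b r \<noteq> 0")
    case True
    then obtain b where b: "b < M" "tent b r \<noteq> 0" by blast
    have "tent c r = 0" if "c \<noteq> b" for c
    proof -
      have "\<bar>real c - real b\<bar> \<ge> 1" using that by linarith
      then show ?thesis using b(2) by (auto simp: tent_def max_def min_def split: if_splits)
    qed
    then have "(\<Sum>c<M. tent c r) = (\<Sum>c\<in>{b}. tent c r)"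
      using b(1) by (intro sum.mono_neutral_right) auto
    then show ?thesis by (simp add: tent_def)
  qed (simp add: sum.neutral)
  have "\<exists>f :: C01. \<forall>t. apply_bcontfun f t
      = apply_bcontfun g t * tent b (Rep_unit_interval t) / alternating M b g" for b
  proof -
    have "continuous_on UNIV (\<lambda>t. apply_bcontfun g t * tent b (Rep_unit_interval t) / alternating M b g)"
    proof -
      have "continuous_on UNIV Rep_unit_interval"
        by (auto simp: continuous_on_iff dist_unit_interval_def)
      then have "continuous_on UNIV (\<lambda>t. tent b (Rep_unit_interval t))"
        by (intro continuous_on_compose2[OF tent_cont]) auto
      then show ?thesis
        unfolding divide_inverse
        by (intro continuous_on_mult continuous_on_const continuous_on_apply_bcontfun)
    qed
    then show ?thesis
      unfolding bcontfun_unit_interval_iff[symmetric]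
      by (intro exI allI) (rule fun_cong, erule Bcontfun_inverse)
  qed
  then obtain f :: "nat \<Rightarrow> C01" where f: "\<And>b t. apply_bcontfun (f b) t
      = apply_bcontfun g t * tent b (Rep_unit_interval t) / alternating M b g"
    by metis
  show thesis
  proof (rule that)
    fix b c assume bc: "b < M" "c < M"
    have lin: "linear (alternating M c)"
      by (rule bounded_linear.linear[OF bounded_linear_alternating])
    have "apply_bcontfun (f b) (atom M c k)
        = apply_bcontfun (if b = c then g /\<^sub>R alternating M b g else 0) (atom M c k)" for k
      using tent_atom[OF bc(2), of b k] by (simp add: f divide_inverse)
    then have "alternating M c (f b) = alternating M c (if b = c then g /\<^sub>R alternating M b g else 0)"
      unfolding alternating_def by (simp only:)
    also have "\<dots> = (if b = c then 1 else 0)"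
      using g(2)[OF bc(1)] assms(2)
      by (auto simp: linear_0[OF lin] linear_scale[OF lin])
    finally show "alternating M c (f b) = (if b = c then 1 else 0)" .
  next
    fix t
    have "\<bar>apply_bcontfun (f b) t\<bar> \<le> tent b (Rep_unit_interval t) / (1 - \<epsilon>)" if "b < M" for b
    proof -
      have "\<bar>apply_bcontfun (f b) t\<bar> = \<bar>apply_bcontfun g t\<bar> * tent b (Rep_unit_interval t) / \<bar>alternating M b g\<bar>"
        by (simp add: f abs_mult tent_def)
      also have "\<dots> \<le> 1 * tent b (Rep_unit_interval t) / (1 - \<epsilon>)"
        using g(1)[of t] g(2)[OF that] assms(2)
        by (intro frac_le mult_right_mono) (auto simp: tent_def)
      finally show ?thesis by simp
    qed
    then have "(\<Sum>b<M. \<bar>apply_bcontfun (f b) t\<bar>) \<le> (\<Sum>b<M. tent b (Rep_unit_interval t) / (1 - \<epsilon>))"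
      by (intro sum_mono) auto
    also have "\<dots> \<le> 1 / (1 - \<epsilon>)"
      using tent_sum assms(2) by (simp add: divide_right_mono flip: sum_divide_distrib)
    finally show "(\<Sum>b<M. \<bar>apply_bcontfun (f b) t\<bar>) \<le> 1 / (1 - \<epsilon>)" .
  qed
qed

section \<open>Projection constants of annihilators\<close>

definition moment :: "nat \<Rightarrow> (nat \<Rightarrow> nat \<Rightarrow> real) \<Rightarrow> nat \<Rightarrow> C01 \<Rightarrow> real" where
  "moment M x i f = (\<Sum>b<M. x b i * alternating M b f)"

definition annihilator :: "nat \<Rightarrow> nat \<Rightarrow> (nat \<Rightarrow> nat \<Rightarrow> real) \<Rightarrow> C01 set" where
  "annihilator M n x = {f. \<forall>i<n. moment M x i f = 0}"

text \<open>
  The norm of the measure \<open>\<Sum>\<^sub>i a\<^sub>i m\<^sub>i\<close>, where \<open>m\<^sub>i\<close> is \<open>moment M x i\<close>: the functionals \<open>alternating M b\<close>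
  span an isometric copy of \<open>\<ell>\<^sub>1\<close>. Vectors of \<open>\<real>\<^sup>n\<close> are functions on the naturals, of which only the
  values below \<open>n\<close> matter.
\<close>

definition row_norm :: "nat \<Rightarrow> nat \<Rightarrow> (nat \<Rightarrow> nat \<Rightarrow> real) \<Rightarrow> (nat \<Rightarrow> real) \<Rightarrow> real" where
  "row_norm M n x a = (\<Sum>b<M. \<bar>\<Sum>i<n. a i * x b i\<bar>)"

lemma row_norm_nonneg: "0 \<le> row_norm M n x a"
  by (simp add: row_norm_def sum_nonneg)

lemma row_norm_sum_le: "row_norm M n x (\<lambda>i. \<Sum>c\<in>C. r c * y c i) \<le> (\<Sum>c\<in>C. \<bar>r c\<bar> * row_norm M n x (y c))"
proof -
  have "(\<Sum>i<n. (\<Sum>c\<in>C. r c * y c i) * x b i) = (\<Sum>c\<in>C. r c * (\<Sum>i<n. y c i * x b i))" for b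
    by (simp add: sum_distrib_right sum_distrib_left mult_ac) (rule sum.swap)
  then have "row_norm M n x (\<lambda>i. \<Sum>c\<in>C. r c * y c i) \<le> (\<Sum>b<M. \<Sum>c\<in>C. \<bar>r c\<bar> * \<bar>\<Sum>i<n. y c i * x b i\<bar>)"
    unfolding row_norm_def by (intro sum_mono) (simp add: sum_abs order_trans[OF sum_abs] abs_mult)
  also have "\<dots> = (\<Sum>c\<in>C. \<bar>r c\<bar> * row_norm M n x (y c))"
    unfolding row_norm_def sum_distrib_left by (rule sum.swap)
  finally show ?thesis .
qed

lemma bounded_linear_moment: "bounded_linear (moment M x i)"
  unfolding moment_def[abs_def]
  by (intro bounded_linear_sum bounded_linear_const_mult bounded_linear_alternating)

lemma moment_sum:
  "moment M x i (\<Sum>c\<in>C. r c *\<^sub>R f c) = (\<Sum>c\<in>C. r c * moment M x i (f c))"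
proof -
  interpret bounded_linear "moment M x i" by (rule bounded_linear_moment)
  show ?thesis by (simp add: sum scaleR)
qed

lemma sum_moment_mult:
  "(\<Sum>i<n. moment M x i f * a i) = (\<Sum>b<M. alternating M b f * (\<Sum>i<n. a i * x b i))"
  unfolding moment_def sum_distrib_left sum_distrib_right
  by (subst sum.swap) (simp add: mult_ac)

lemma subspace_annihilator: "subspace (annihilator M n x)"
proof -
  have "linear (moment M x i)" for i
    by (rule bounded_linear.linear[OF bounded_linear_moment])
  then show ?thesis
    by (auto simp: subspace_def annihilator_def linear_0 linear_add linear_scale)
qed

lemma closed_annihilator: "closed (annihilator M n x)"
proof -
  have "annihilator M n x = (\<Inter>i\<in>{..<n}. moment M x i -` {0})"
    by (auto simp: annihilator_def)
  moreover have "closed (moment M x i -` {0})" for i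
    using bounded_linear.continuous[OF bounded_linear_moment continuous_ident]
    by (intro continuous_closed_vimage) auto
  ultimately show ?thesis by auto
qed

lemma apply_bcontfun_sum: "apply_bcontfun (\<Sum>c\<in>C. f c) t = (\<Sum>c\<in>C. apply_bcontfun (f c) t)"
  by (induction C rule: infinite_finite_induct) auto

definition dual_system :: "nat \<Rightarrow> nat \<Rightarrow> (nat \<Rightarrow> nat \<Rightarrow> real) \<Rightarrow> (nat \<Rightarrow> C01) \<Rightarrow> bool" where
  "dual_system M n x g \<longleftrightarrow> (\<forall>i<n. \<forall>j<n. moment M x j (g i) = (if i = j then 1 else 0))"

lemma dual_system_complement:
  assumes "dual_system M n x g"
  shows "f - (\<Sum>i<n. moment M x i f *\<^sub>R g i) \<in> annihilator M n x"
proof -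
  have "moment M x j (f - (\<Sum>i<n. moment M x i f *\<^sub>R g i)) = 0" if "j < n" for j
  proof -
    have "moment M x j (f - (\<Sum>i<n. moment M x i f *\<^sub>R g i))
        = moment M x j f - (\<Sum>i<n. moment M x i f * moment M x j (g i))"
      by (simp add: linear_diff[OF bounded_linear.linear[OF bounded_linear_moment]] moment_sum)
    also have "(\<Sum>i<n. moment M x i f * moment M x j (g i)) = (\<Sum>i<n. if i = j then moment M x i f else 0)"
      using assms that by (intro sum.cong) (auto simp: dual_system_def)
    finally show ?thesis using that by simp
  qed
  then show ?thesis by (simp add: annihilator_def)
qed

lemma finite_codimensional_annihilator:
  assumes "dual_system M n x g"
  shows "finite_codimensional (annihilator M n x)"
  unfolding finite_codimensional_def
proof (intro conjI exI allI)
  fix f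
  show "\<exists>b\<in>span (g ` {..<n}). f - b \<in> annihilator M n x"
    using dual_system_complement[OF assms, of f]
    by (intro bexI[of _ "\<Sum>i<n. moment M x i f *\<^sub>R g i"])
      (simp, intro span_sum span_scale span_base imageI)
qed (auto simp: subspace_annihilator)

text \<open>
  \<open>P\<close> fixes \<open>f - \<Sum>\<^sub>i m\<^sub>i(f) g\<^sub>i\<close>, which lies in the annihilator; so \<open>P\<close> is determined by its values on the
  dual system, that is, by the curve with coordinates \<open>g\<^sub>i - P g\<^sub>i\<close>.
\<close>

lemma projection_decomposition:
  assumes "dual_system M n x g" "P \<in> projections_onto (annihilator M n x)"
  shows "apply_bcontfun (blinfun_apply P f) t = apply_bcontfun f t
    - (\<Sum>b<M. alternating M b f * (\<Sum>i<n. apply_bcontfun (g i - blinfun_apply P (g i)) t * x b i))"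
proof -
  let ?s = "\<Sum>i<n. moment M x i f *\<^sub>R g i"
  have "blinfun_apply P (f - ?s) = f - ?s"
    using assms(2) dual_system_complement[OF assms(1), of f] by (simp add: projections_onto_def)
  then have "blinfun_apply P f = f - (\<Sum>i<n. moment M x i f *\<^sub>R (g i - blinfun_apply P (g i)))"
    by (simp add: blinfun.bilinear_simps blinfun.sum_right scaleR_diff_right sum_subtractf algebra_simps)
  then show ?thesis
    by (simp add: apply_bcontfun_sum flip: sum_moment_mult)
qed

text \<open>
  At a point \<open>t\<close> that is not an atom, a function with value \<open>1\<close> at \<open>t\<close> that nearly norms every
  \<open>alternating M b\<close> with the sign opposite to its coefficient in the decomposition of \<open>P\<close> makes the
  two parts of \<open>P f t\<close> add up. The remaining points follow by continuity.
\<close>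

lemma row_norm_le_norm_projection:
  assumes g: "dual_system M n x g" and P: "P \<in> projections_onto (annihilator M n x)"
  shows "1 + row_norm M n x (\<lambda>i. apply_bcontfun (g i - blinfun_apply P (g i)) t) \<le> norm P"
proof -
  define F where "F = (\<lambda>i. g i - blinfun_apply P (g i))"
  define N where "N = (\<lambda>u. row_norm M n x (\<lambda>i. apply_bcontfun (F i) u))"
  have "N t \<le> norm P - 1"
  proof (rule le_of_le_off_atoms)
    show "continuous_on UNIV N"
      unfolding N_def row_norm_def by (intro continuous_intros) auto
    fix u assume u: "u \<notin> {atom M b k |b k. b < M}"
    define c where "c = (\<lambda>b. \<Sum>i<n. apply_bcontfun (F i) u * x b i)"
    define \<sigma> where "\<sigma> = (\<lambda>b. if c b > 0 then - 1 else 1 :: real)"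
    have N0: "0 \<le> N u" by (simp add: N_def row_norm_nonneg)
    show "N u \<le> norm P - 1"
    proof (rule field_le_epsilon)
      fix e :: real assume "0 < e"
      \<comment> \<open>\<open>N u\<close> may vanish, hence the summand \<open>1\<close>\<close>
      define \<epsilon> where "\<epsilon> = e / (N u + 1)"
      have \<epsilon>: "0 < \<epsilon>" "\<epsilon> * N u \<le> e"
        using \<open>0 < e\<close> N0 by (auto simp: \<epsilon>_def field_simps)
      obtain f :: C01 where f: "\<And>u. \<bar>apply_bcontfun f u\<bar> \<le> 1" "apply_bcontfun f u = 1"
        "\<And>b. b < M \<Longrightarrow> 1 - \<epsilon> \<le> \<sigma> b * alternating M b f"
      proof (rule alternating_near_norming[OF u _ \<epsilon>(1), of \<sigma>])
        show "\<bar>\<sigma> b\<bar> = 1" for b by (simp add: \<sigma>_def)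
      qed blast
      have "(1 - \<epsilon>) * N u = (\<Sum>b<M. (1 - \<epsilon>) * \<bar>c b\<bar>)"
        by (simp add: N_def row_norm_def c_def sum_distrib_left)
      also have "\<dots> \<le> (\<Sum>b<M. - (alternating M b f * c b))"
      proof (rule sum_mono)
        fix b assume "b \<in> {..<M}"
        then have "(1 - \<epsilon>) * \<bar>c b\<bar> \<le> \<sigma> b * alternating M b f * \<bar>c b\<bar>"
          using f(3) by (intro mult_right_mono) auto
        then show "(1 - \<epsilon>) * \<bar>c b\<bar> \<le> - (alternating M b f * c b)"
          by (auto simp: \<sigma>_def abs_if split: if_splits)
      qed
      also have "\<dots> = apply_bcontfun (blinfun_apply P f) u - 1"
        using projection_decomposition[OF g P, of f u] f(2)
        by (simp add: c_def F_def sum_negf)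
      also have "\<dots> \<le> norm P - 1"
      proof -
        have "apply_bcontfun (blinfun_apply P f) u \<le> norm (blinfun_apply P f)"
          using norm_bounded[of "blinfun_apply P f" u] by simp
        also have "\<dots> \<le> norm P * norm f" by (rule norm_blinfun)
        also have "\<dots> \<le> norm P * 1"
          using f(1) by (intro mult_left_mono norm_bound) auto
        finally show ?thesis by simp
      qed
      finally show "N u \<le> norm P - 1 + e"
        using \<epsilon>(2) by (simp add: algebra_simps)
    qed
  qed
  then show ?thesis by (simp add: N_def F_def)
qed

text \<open>
  Trace duality: \<open>n\<close> is the trace of \<open>I - P\<close>. Expanded over the blocks, it is the sum of the
  functionals \<open>alternating M b\<close> at the functions \<open>\<langle>F, x\<^sub>b\<rangle>\<close>, each of which is bounded by
  \<open>w\<^sub>b (\<parallel>P\<parallel> - 1)\<close>. The inequality is strict because the functionals do not attain their norm.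
\<close>

lemma trace_less:
  assumes g: "dual_system M n x g" and P: "P \<in> projections_onto (annihilator M n x)"
    and w: "\<And>b a. b < M \<Longrightarrow> \<bar>\<Sum>i<n. a i * x b i\<bar> \<le> w b * row_norm M n x a"
    and c: "c < M" "0 < w c"  and wpos: "\<And>b. b < M \<Longrightarrow> 0 \<le> w b" and "0 < n"
  shows "real n < (norm P - 1) * (\<Sum>b<M. w b)"
proof -
  define F where "F = (\<lambda>i. g i - blinfun_apply P (g i))"
  define G where "G = (\<lambda>b. \<Sum>i<n. x b i *\<^sub>R F i)"
  have bound: "\<bar>apply_bcontfun (G b) t\<bar> \<le> w b * (norm P - 1)" if "b < M" for b t
  proof -
    have "\<bar>apply_bcontfun (G b) t\<bar> = \<bar>\<Sum>i<n. apply_bcontfun (F i) t * x b i\<bar>"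
      by (simp add: G_def apply_bcontfun_sum mult_ac)
    also have "\<dots> \<le> w b * row_norm M n x (\<lambda>i. apply_bcontfun (F i) t)"
      by (rule w[OF that])
    also have "\<dots> \<le> w b * (norm P - 1)"
      using row_norm_le_norm_projection[OF g P, of t] wpos[OF that]
      by (intro mult_left_mono) (auto simp: F_def)
    finally show ?thesis .
  qed
  have "moment M x i (F i) = 1" if "i < n" for i
  proof -
    have "moment M x i (F i) = moment M x i (g i) - moment M x i (blinfun_apply P (g i))"
      unfolding F_def by (rule linear_diff[OF bounded_linear.linear[OF bounded_linear_moment]])
    also have "moment M x i (blinfun_apply P (g i)) = 0"
      using P that by (auto simp: projections_onto_def annihilator_def)
    finally show ?thesis using g that by (simp add: dual_system_def)
  qed
  then have "real n = (\<Sum>i<n. moment M x i (F i))" by simp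
  also have "\<dots> = (\<Sum>b<M. \<Sum>i<n. x b i * alternating M b (F i))"
    unfolding moment_def by (rule sum.swap)
  also have "\<dots> = (\<Sum>b<M. alternating M b (G b))"
  proof (rule sum.cong[OF refl])
    fix b
    interpret bounded_linear "alternating M b" by (rule bounded_linear_alternating)
    show "(\<Sum>i<n. x b i * alternating M b (F i)) = alternating M b (G b)"
      by (simp add: G_def sum scaleR)
  qed
  finally have n_eq: "real n = (\<Sum>b<M. alternating M b (G b))" .
  have le: "alternating M b (G b) \<le> w b * (norm P - 1)" if "b < M" for b
    using alternating_bound[of "G b", OF bound[OF that]] by (meson abs_le_D1)
  have "real n \<le> (norm P - 1) * (\<Sum>b<M. w b)"
    unfolding n_eq using le by (auto simp: sum_distrib_left mult_ac intro!: sum_mono)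
  then have "norm P - 1 \<noteq> 0" using \<open>0 < n\<close> by auto
  moreover have "0 \<le> norm P - 1"
    using order_trans[OF add_left_mono[OF row_norm_nonneg] row_norm_le_norm_projection[OF g P]] by simp
  ultimately have "0 < w c * (norm P - 1)" using c by auto
  then have "alternating M c (G c) < w c * (norm P - 1)"
    using bound[OF c(1)] c(1) by (intro alternating_less) auto
  then show ?thesis
    unfolding n_eq sum_distrib_left using le c(1)
    by (intro sum_strict_mono_ex1) (auto simp: mult_ac)
qed

text \<open>
  The curve \<open>\<Sum>\<^sub>b f\<^sub>b y\<^sub>b\<close> with disjointly supported \<open>f\<^sub>b\<close> stays, up to the factor \<open>1 / (1 - \<epsilon>)\<close>, in
  the convex hull of the vectors \<open>\<plusminus> y\<^sub>b\<close> and so in the ball of radius \<open>\<rho>\<close>. The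
  vectors \<open>y\<^sub>b\<close> resolve the identity, which makes its coordinates dual to the moments.
\<close>

lemma projection_with_norm_near:
  assumes dual: "\<And>i j. i < n \<Longrightarrow> j < n \<Longrightarrow> (\<Sum>b<M. y b i * x b j) = (if i = j then 1 else 0)"
    and y: "\<And>b. b < M \<Longrightarrow> row_norm M n x (y b) \<le> \<rho>" and "0 \<le> \<rho>" "0 < \<epsilon>" "\<epsilon> < 1"
  obtains g P where "dual_system M n x g" "P \<in> projections_onto (annihilator M n x)"
    "norm P \<le> 1 + \<rho> / (1 - \<epsilon>)"
proof -
  obtain f :: "nat \<Rightarrow> C01" where f:
    "\<And>b c. b < M \<Longrightarrow> c < M \<Longrightarrow> alternating M c (f b) = (if b = c then 1 else 0)"
    "\<And>t. (\<Sum>b<M. \<bar>apply_bcontfun (f b) t\<bar>) \<le> 1 / (1 - \<epsilon>)"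
    using disjoint_biorthogonal_functions[OF assms(4,5), of M] by blast
  define g where "g = (\<lambda>i. \<Sum>b<M. y b i *\<^sub>R f b)"
  have g: "dual_system M n x g"
    unfolding dual_system_def
  proof (intro allI impI)
    fix i j assume ij: "i < n" "j < n"
    have "moment M x j (f b) = x b j" if "b < M" for b
    proof -
      have "moment M x j (f b) = (\<Sum>c<M. if c = b then x c j else 0)"
        unfolding moment_def using f(1)[OF that] by (intro sum.cong) auto
      then show ?thesis using that by simp
    qed
    then have "moment M x j (g i) = (\<Sum>b<M. y b i * x b j)"
      by (simp add: g_def moment_sum)
    then show "moment M x j (g i) = (if i = j then 1 else 0)"
      using dual[OF ij] by simp
  qed
  have row: "row_norm M n x (\<lambda>i. apply_bcontfun (g i) t) \<le> \<rho> / (1 - \<epsilon>)" for t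
  proof -
    have "row_norm M n x (\<lambda>i. apply_bcontfun (g i) t)
        = row_norm M n x (\<lambda>i. \<Sum>b<M. apply_bcontfun (f b) t * y b i)"
      by (simp add: g_def apply_bcontfun_sum mult_ac)
    also have "\<dots> \<le> (\<Sum>b<M. \<bar>apply_bcontfun (f b) t\<bar> * row_norm M n x (y b))"
      by (rule row_norm_sum_le)
    also have "\<dots> \<le> (\<Sum>b<M. \<bar>apply_bcontfun (f b) t\<bar> * \<rho>)"
      using y by (intro sum_mono mult_left_mono) auto
    also have "\<dots> \<le> 1 / (1 - \<epsilon>) * \<rho>"
      using f(2)[of t] \<open>0 \<le> \<rho>\<close> by (simp only: flip: sum_distrib_right) (rule mult_right_mono)
    finally show ?thesis by simp
  qed
  define p where "p = (\<lambda>h. h - (\<Sum>i<n. moment M x i h *\<^sub>R g i))"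
  have p: "bounded_linear p"
    unfolding p_def
    by (intro bounded_linear_sub bounded_linear_ident bounded_linear_sum
        bounded_linear_compose[OF bounded_linear_scaleR_left bounded_linear_moment])
  have "norm (p h) \<le> (1 + \<rho> / (1 - \<epsilon>)) * norm h" for h
  proof (rule norm_bound)
    fix t
    have "apply_bcontfun (p h) t = apply_bcontfun h t
        - (\<Sum>b<M. alternating M b h * (\<Sum>i<n. apply_bcontfun (g i) t * x b i))"
      by (simp add: p_def apply_bcontfun_sum sum_moment_mult)
    also have "\<bar>\<dots>\<bar> \<le> norm h + (\<Sum>b<M. norm h * \<bar>\<Sum>i<n. apply_bcontfun (g i) t * x b i\<bar>)"
    proof (rule order_trans[OF abs_triangle_ineq4 add_mono])
      show "\<bar>apply_bcontfun h t\<bar> \<le> norm h"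
        using norm_bounded[of h t] by simp
      have "\<bar>alternating M b h\<bar> \<le> norm h" for b
        using norm_bounded[of h] by (intro alternating_bound) auto
      then show "\<bar>\<Sum>b<M. alternating M b h * (\<Sum>i<n. apply_bcontfun (g i) t * x b i)\<bar>
          \<le> (\<Sum>b<M. norm h * \<bar>\<Sum>i<n. apply_bcontfun (g i) t * x b i\<bar>)"
        by (intro order_trans[OF sum_abs] sum_mono) (simp add: abs_mult mult_right_mono)
    qed
    also have "\<dots> = norm h + norm h * row_norm M n x (\<lambda>i. apply_bcontfun (g i) t)"
      by (simp add: row_norm_def sum_distrib_left)
    also have "\<dots> \<le> norm h + norm h * (\<rho> / (1 - \<epsilon>))"
      using row by (intro add_left_mono mult_left_mono) auto
    finally show "norm (apply_bcontfun (p h) t) \<le> (1 + \<rho> / (1 - \<epsilon>)) * norm h"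
      by (simp add: algebra_simps)
  qed
  then have "norm (Blinfun p) \<le> 1 + \<rho> / (1 - \<epsilon>)"
    using assms(3-5) by (intro norm_blinfun_bound) (auto simp: bounded_linear_Blinfun_apply[OF p])
  moreover have "Blinfun p \<in> projections_onto (annihilator M n x)"
    unfolding projections_onto_def
  proof (intro CollectI conjI ballI)
    show "range (blinfun_apply (Blinfun p)) \<subseteq> annihilator M n x"
      unfolding bounded_linear_Blinfun_apply[OF p] using dual_system_complement[OF g]
      by (auto simp: p_def)
    show "blinfun_apply (Blinfun p) h = h" if "h \<in> annihilator M n x" for h
      unfolding bounded_linear_Blinfun_apply[OF p] using that by (simp add: p_def annihilator_def)
  qed
  ultimately show thesis using that g by blast
qed

text \<open>
  The vectors \<open>y\<^sub>b\<close> certify the upper bound and the weights \<open>w\<^sub>b\<close> the lower bound; the last hypothesis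
  says that the two certificates match.
\<close>

theorem projection_constant_annihilator:
  assumes "0 < n" "0 < \<rho>"
    and dual: "\<And>i j. i < n \<Longrightarrow> j < n \<Longrightarrow> (\<Sum>b<M. y b i * x b j) = (if i = j then 1 else 0)"
    and y: "\<And>b. b < M \<Longrightarrow> row_norm M n x (y b) \<le> \<rho>"
    and w: "\<And>b a. b < M \<Longrightarrow> \<bar>\<Sum>i<n. a i * x b i\<bar> \<le> w b * row_norm M n x a"
    and w0: "\<And>b. b < M \<Longrightarrow> 0 \<le> w b"
    and sum_w: "\<rho> * (\<Sum>b<M. w b) = real n"
  shows "finite_codimensional (annihilator M n x)"
    and "projection_constant (annihilator M n x) = ereal (1 + \<rho>)"
    and "\<not> projection_constant_attained (annihilator M n x)"
proof -
  let ?Y = "annihilator M n x"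
  obtain g where g: "dual_system M n x g"
    using projection_with_norm_near[where M = M and y = y and x = x and \<rho> = \<rho> and \<epsilon> = "1/2", OF dual y] \<open>0 < \<rho>\<close>
    by auto
  then show "finite_codimensional ?Y" by (rule finite_codimensional_annihilator)
  have "0 < (\<Sum>b<M. w b)"
    using sum_w \<open>0 < n\<close> \<open>0 < \<rho>\<close> by (metis of_nat_0_less_iff zero_less_mult_pos)
  then obtain c where c: "c < M" "0 < w c"
    by (metis lessThan_iff linorder_not_less sum_nonpos)
  have strict: "1 + \<rho> < norm P" if "P \<in> projections_onto ?Y" for P
  proof -
    have "\<rho> * (\<Sum>b<M. w b) < (norm P - 1) * (\<Sum>b<M. w b)"
      unfolding sum_w by (rule trace_less[OF g that w c w0 \<open>0 < n\<close>])
    then have "\<rho> < norm P - 1"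
      using \<open>0 < (\<Sum>b<M. w b)\<close> by simp
    then show ?thesis by simp
  qed
  show const: "projection_constant ?Y = ereal (1 + \<rho>)"
    unfolding projection_constant_def
  proof (rule INF_eqI)
    show "ereal (1 + \<rho>) \<le> ereal (norm P)" if "P \<in> projections_onto ?Y" for P
      using strict[OF that] by simp
    fix z assume z: "\<And>P. P \<in> projections_onto ?Y \<Longrightarrow> z \<le> ereal (norm P)"
    show "z \<le> ereal (1 + \<rho>)"
    proof (rule ereal_le_epsilon2)
      fix e :: real assume "0 < e"
      \<comment> \<open>the solution of \<open>\<rho> / (1 - \<epsilon>) = \<rho> + e\<close>\<close>
      define \<epsilon> where "\<epsilon> = e / (\<rho> + e)"
      have \<epsilon>: "0 < \<epsilon>" "\<epsilon> < 1" "\<rho> / (1 - \<epsilon>) = \<rho> + e"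
        using \<open>0 < e\<close> \<open>0 < \<rho>\<close> by (auto simp: \<epsilon>_def field_simps)
      obtain P where "P \<in> projections_onto ?Y" "norm P \<le> 1 + \<rho> / (1 - \<epsilon>)"
        using projection_with_norm_near[where M = M and y = y and x = x and \<rho> = \<rho>, OF dual y _ \<epsilon>(1,2)] \<open>0 < \<rho>\<close>
        by auto
      then have "z \<le> ereal (norm P)" "norm P \<le> 1 + \<rho> + e"
        using z \<epsilon>(3) by auto
      then show "z \<le> ereal (1 + \<rho>) + ereal e"
        using order_trans by fastforce
    qed
  qed
  show "\<not> projection_constant_attained ?Y"
    unfolding projection_constant_attained_def const using strict by fastforce
qed

section \<open>The extremal spaces built from Sylvester matrices\<close>

text \<open>
  The Sylvester-Hadamard matrix of order \<open>2\<^sup>k\<close>: the entry is \<open>-1\<close> to the number of binary digits equal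
  to \<open>1\<close> in both indices.
\<close>

fun sylvester :: "nat \<Rightarrow> nat \<Rightarrow> nat \<Rightarrow> real" where
  "sylvester 0 i j = 1"
| "sylvester (Suc k) i j = (if odd i \<and> odd j then -1 else 1) * sylvester k (i div 2) (j div 2)"

lemma sylvester_sym: "sylvester k i j = sylvester k j i"
  by (induction k arbitrary: i j) (auto simp: conj_commute)

lemma abs_sylvester: "\<bar>sylvester k i j\<bar> = 1"
  by (induction k arbitrary: i j) (auto simp: abs_mult)

lemma sum_even_odd: "(\<Sum>l<2 * n. f l) = (\<Sum>l<n. f (2 * l) + f (2 * l + 1 :: nat))"
  for f :: "nat \<Rightarrow> 'a :: comm_monoid_add"
  by (induction n) (auto simp: add_ac)

lemma sylvester_orthogonal:
  assumes "i < 2 ^ k" "j < 2 ^ k"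
  shows "(\<Sum>l<2 ^ k. sylvester k l i * sylvester k l j) = (if i = j then 2 ^ k else 0)"
  using assms
proof (induction k arbitrary: i j)
  case (Suc k)
  have "(\<Sum>l<2 ^ Suc k. sylvester (Suc k) l i * sylvester (Suc k) l j)
      = (\<Sum>l<2 ^ k. (1 + (if odd i \<longleftrightarrow> odd j then 1 else -1))
          * (sylvester k l (i div 2) * sylvester k l (j div 2)))"
    unfolding power_Suc sum_even_odd by (intro sum.cong) auto
  also have "\<dots> = (1 + (if odd i \<longleftrightarrow> odd j then 1 else -1)) * (if i div 2 = j div 2 then 2 ^ k else 0)"
    using Suc.prems Suc.IH[of "i div 2" "j div 2"] by (simp flip: sum_distrib_left)
  also have "\<dots> = (if i = j then 2 ^ Suc k else 0)"
  proof -
    have "i = j" if "i div 2 = j div 2" "odd i \<longleftrightarrow> odd j"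
      using that by (metis bit_eq_rec)
    then show ?thesis by auto
  qed
  finally show ?case .
qed auto

text \<open>
  Fourier inversion: \<open>a j\<close> is the mean over \<open>l\<close> of the transform of \<open>a\<close> at \<open>l\<close>, multiplied by the
  sign \<open>sylvester k l j\<close>.
\<close>

lemma sylvester_row_norm_ge:
  assumes "j < 2 ^ k"
  shows "2 ^ k * \<bar>a j\<bar> \<le> (\<Sum>l<2 ^ k. \<bar>\<Sum>i<2 ^ k. a i * sylvester k l i\<bar>)"
proof -
  have "(\<Sum>l<2 ^ k. sylvester k l j * (\<Sum>i<2 ^ k. a i * sylvester k l i))
      = (\<Sum>i<2 ^ k. a i * (\<Sum>l<2 ^ k. sylvester k l j * sylvester k l i))"
    unfolding sum_distrib_left by (subst sum.swap) (simp add: mult_ac)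
  also have "\<dots> = (\<Sum>i<2 ^ k. if i = j then a i * 2 ^ k else 0)"
    using assms by (intro sum.cong) (auto simp: sylvester_orthogonal)
  also have "\<dots> = 2 ^ k * a j" using assms by simp
  finally have "2 ^ k * \<bar>a j\<bar> = \<bar>\<Sum>l<2 ^ k. sylvester k l j * (\<Sum>i<2 ^ k. a i * sylvester k l i)\<bar>"
    by (simp add: abs_mult)
  also have "\<dots> \<le> (\<Sum>l<2 ^ k. \<bar>\<Sum>i<2 ^ k. a i * sylvester k l i\<bar>)"
    by (rule order_trans[OF sum_abs]) (simp add: abs_mult abs_sylvester)
  finally show ?thesis .
qed

lemma sum_two_blocks:
  fixes n m :: nat
  shows "(\<Sum>b<n + m. if b < n then f b else g (b - n)) = (\<Sum>b<n. f b) + (\<Sum>b<m. g b)"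
  by (induction m) (auto simp: add_ac)

lemma parameter_exists:
  fixes \<rho> n :: real
  assumes "1 \<le> \<rho>" "1 \<le> n" "2 * \<rho> \<le> 1 + sqrt n"
  obtains s where "0 \<le> s" "1 / (1 + s) + s / (n + s) = 1 / \<rho>"
proof -
  let ?h = "\<lambda>s. 1 / (1 + s) + s / (n + s)"
  have r: "0 < sqrt n" "n = sqrt n * sqrt n" using assms(2) by auto
  have "sqrt n / (n + sqrt n) = 1 / (1 + sqrt n)"
    using r by (metis (no_types) distrib_left mult.right_neutral mult_divide_mult_cancel_left less_irrefl add.commute)
  then have "?h (sqrt n) = 2 / (1 + sqrt n)" by simp
  also have "\<dots> \<le> 1 / \<rho>"
    using assms r by (simp add: field_simps)
  finally have "?h (sqrt n) \<le> 1 / \<rho>" .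
  moreover have "1 / \<rho> \<le> ?h 0" using assms(1) by simp
  ultimately have "\<exists>s\<ge>0. s \<le> sqrt n \<and> ?h s = 1 / \<rho>"
    using assms(2) by (intro IVT2') (auto intro!: continuous_intros)
  then show thesis using that by blast
qed

text \<open>
  Here \<open>N(a)\<close> is the mean of \<open>\<bar>\<langle>a, h\<^sub>j\<rangle>\<bar>\<close> over \<open>j\<close> plus \<open>s / n\<close> times the \<open>\<ell>\<^sub>1\<close>-norm. Both \<open>\<bar>\<langle>a, h\<^sub>j\<rangle>\<bar> / n\<close> and
  \<open>\<bar>a\<^sub>i\<bar>\<close> are at most that mean, and both \<open>\<bar>\<langle>a, h\<^sub>j\<rangle>\<bar>\<close> and \<open>\<bar>a\<^sub>i\<bar>\<close> are at most the \<open>\<ell>\<^sub>1\<close>-norm. Therefore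
  \<open>(1 + s) / n * \<bar>\<langle>a, h\<^sub>j\<rangle>\<bar> \<le> N(a)\<close> and \<open>(1 + s / n) * \<bar>a\<^sub>i\<bar> \<le> N(a)\<close>, with equality for \<open>a = h\<^sub>j\<close> and \<open>a = e\<^sub>i\<close>
  respectively. The vectors \<open>y\<^sub>b\<close> are the multiples of \<open>h\<^sub>j\<close> and \<open>e\<^sub>i\<close> with \<open>N(y\<^sub>b) = \<rho>\<close>; the weights \<open>w\<^sub>b\<close> are the
  best constants in the two inequalities. The equation for \<open>s\<close> is both \<open>\<Sum>\<^sub>b y\<^sub>b \<otimes> x\<^sub>b = I\<close> and the
  matching condition \<open>\<rho> \<Sum>\<^sub>b w\<^sub>b = n\<close>.
\<close>

theorem sylvester_projection_constant:
  fixes k :: nat and s \<rho> :: real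
  assumes "0 \<le> s" "0 < \<rho>" and s: "1 / (1 + s) + s / (2 ^ k + s) = 1 / \<rho>"
  defines "n \<equiv> 2 ^ k :: nat"
  defines "x \<equiv> (\<lambda>b i. if b < n then sylvester k b i / n else s / n * of_bool (b - n = i))"
  shows "finite_codimensional (annihilator (n + n) n x)"
    and "projection_constant (annihilator (n + n) n x) = ereal (1 + \<rho>)"
    and "\<not> projection_constant_attained (annihilator (n + n) n x)"
proof -
  have n: "0 < n" "real n = 2 ^ k" by (auto simp: n_def)
  define y where "y = (\<lambda>b i. if b < n then \<rho> / (1 + s) * sylvester k b i
    else \<rho> * n / (n + s) * of_bool (b - n = i))"
  define w where "w = (\<lambda>b. if b < n then 1 / (1 + s) else s / (n + s))"
  have pairing: "\<bar>\<Sum>i<n. a i * x b i\<bar> = (if b < n then \<bar>\<Sum>i<n. a i * sylvester k b i\<bar> / n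
      else s / n * \<bar>a (b - n)\<bar>)" if "b < n + n" for a b
  proof (cases "b < n")
    case True
    then have "(\<Sum>i<n. a i * x b i) = (\<Sum>i<n. a i * sylvester k b i) / n"
      by (simp add: x_def sum_divide_distrib)
    then show ?thesis using True by simp
  next
    case False
    then have "(\<Sum>i<n. a i * x b i) = (\<Sum>i<n. if i = b - n then s / n * a i else 0)"
      by (intro sum.cong) (auto simp: x_def)
    also have "\<dots> = s / n * a (b - n)" using False that by simp
    finally show ?thesis using False \<open>0 \<le> s\<close> by (simp add: abs_mult)
  qed
  have row_norm: "row_norm (n + n) n x a
      = (\<Sum>l<n. \<bar>\<Sum>i<n. a i * sylvester k l i\<bar>) / n + s / n * (\<Sum>i<n. \<bar>a i\<bar>)" for a
  proof -
    have "row_norm (n + n) n x a = (\<Sum>b<n + n. if b < n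
        then \<bar>\<Sum>i<n. a i * sylvester k b i\<bar> / n else s / n * \<bar>a (b - n)\<bar>)"
      unfolding row_norm_def using pairing by (intro sum.cong) auto
    also have "\<dots> = (\<Sum>l<n. \<bar>\<Sum>i<n. a i * sylvester k l i\<bar> / n) + (\<Sum>i<n. s / n * \<bar>a i\<bar>)"
      by (rule sum_two_blocks)
    finally show ?thesis
      by (simp add: sum_divide_distrib sum_distrib_left)
  qed
  have orth: "(\<Sum>l<n. sylvester k l i * sylvester k l j) = (if i = j then real n else 0)"
    if "i < n" "j < n" for i j
    using sylvester_orthogonal[of i k j] that by (simp add: n_def)
  have dual: "(\<Sum>b<n + n. y b i * x b j) = (if i = j then 1 else 0)" if ij: "i < n" "j < n" for i j
  proof -
    have "(\<Sum>b<n + n. y b i * x b j) = (\<Sum>b<n + n. if b < n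
        then \<rho> / (1 + s) / n * (sylvester k b i * sylvester k b j)
        else \<rho> * s / (n + s) * (of_bool (b - n = i) * of_bool (b - n = j)))"
      using n by (intro sum.cong) (auto simp: x_def y_def)
    also have "\<dots> = (\<Sum>b<n. \<rho> / (1 + s) / n * (sylvester k b i * sylvester k b j))
        + (\<Sum>b<n. \<rho> * s / (n + s) * (of_bool (b = i) * of_bool (b = j)))"
      by (rule sum_two_blocks)
    also have "(\<Sum>b<n. \<rho> * s / (n + s) * (of_bool (b = i) * of_bool (b = j)))
        = (\<Sum>b<n. if b = i then \<rho> * s / (n + s) * of_bool (i = j) else 0)"
      by (intro sum.cong) auto
    also have "(\<Sum>b<n. \<rho> / (1 + s) / n * (sylvester k b i * sylvester k b j))
        = \<rho> / (1 + s) / n * (if i = j then real n else 0)"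
      by (simp only: orth[OF ij] flip: sum_distrib_left)
    finally have "(\<Sum>b<n + n. y b i * x b j)
        = (if i = j then \<rho> * (1 / (1 + s) + s / (n + s)) else 0)"
      using ij n(1) by (simp add: distrib_left)
    then show ?thesis
      using s n(2) \<open>0 < \<rho>\<close> by simp
  qed
  have y_norm: "row_norm (n + n) n x (y b) \<le> \<rho>" if "b < n + n" for b
  proof (cases "b < n")
    case True
    have "(\<Sum>i<n. y b i * sylvester k l i) = \<rho> / (1 + s) * (if l = b then real n else 0)"
      if "l < n" for l
    proof -
      have "(\<Sum>i<n. y b i * sylvester k l i)
          = \<rho> / (1 + s) * (\<Sum>i<n. sylvester k i b * sylvester k i l)"
        using True by (simp add: y_def sum_distrib_left mult_ac sylvester_sym[of k b] sylvester_sym[of k l])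
      then show ?thesis using orth[OF True that] by simp
    qed
    then have "(\<Sum>l<n. \<bar>\<Sum>i<n. y b i * sylvester k l i\<bar>) = (\<Sum>l<n. if l = b then \<rho> / (1 + s) * n else 0)"
      using \<open>0 \<le> s\<close> \<open>0 < \<rho>\<close> by (intro sum.cong) auto
    moreover have "(\<Sum>i<n. \<bar>y b i\<bar>) = n * (\<rho> / (1 + s))"
      using True \<open>0 \<le> s\<close> \<open>0 < \<rho>\<close> by (simp add: y_def abs_mult abs_sylvester)
    ultimately have "row_norm (n + n) n x (y b) = \<rho> / (1 + s) + s * (\<rho> / (1 + s))"
      unfolding row_norm using True n(1) by simp
    also have "\<dots> = (1 + s) * (\<rho> / (1 + s))" by (simp only: distrib_right mult_1)
    also have "\<dots> = \<rho>" using \<open>0 \<le> s\<close> by simp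
    finally show ?thesis by simp
  next
    case False
    define d where "d = \<rho> * n / (n + s)"
    have "0 \<le> d" using \<open>0 \<le> s\<close> \<open>0 < \<rho>\<close> by (simp add: d_def)
    have y: "y b i = d * of_bool (i = b - n)" for i
      using False by (auto simp: y_def d_def)
    have "(\<Sum>i<n. y b i * sylvester k l i) = (\<Sum>i<n. if i = b - n then d * sylvester k l i else 0)" for l
      by (intro sum.cong) (auto simp: y)
    then have "(\<Sum>i<n. y b i * sylvester k l i) = d * sylvester k l (b - n)" for l
      using False that by simp
    then have "(\<Sum>l<n. \<bar>\<Sum>i<n. y b i * sylvester k l i\<bar>) = n * d"
      using \<open>0 \<le> d\<close> by (simp add: abs_mult abs_sylvester)
    moreover have "(\<Sum>i<n. \<bar>y b i\<bar>) = (\<Sum>i<n. if i = b - n then d else 0)"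
      using \<open>0 \<le> d\<close> by (intro sum.cong) (auto simp: y)
    ultimately have "row_norm (n + n) n x (y b) = d + s / n * d"
      unfolding row_norm using False that n(1) by simp
    also have "\<dots> = (n + s) * d / n" using n(1) by (simp add: field_simps)
    also have "\<dots> = \<rho>" using \<open>0 \<le> s\<close> n(1) by (simp add: d_def)
    finally show ?thesis by simp
  qed
  have w_bound: "\<bar>\<Sum>i<n. a i * x b i\<bar> \<le> w b * row_norm (n + n) n x a" if "b < n + n" for b a
  proof -
    define H where "H = (\<Sum>l<n. \<bar>\<Sum>i<n. a i * sylvester k l i\<bar>)"
    define L where "L = (\<Sum>i<n. \<bar>a i\<bar>)"
    have N: "row_norm (n + n) n x a = (H + s * L) / n"
      by (simp add: row_norm H_def L_def add_divide_distrib)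
    show ?thesis
    proof (cases "b < n")
      case True
      define u where "u = \<bar>\<Sum>i<n. a i * sylvester k b i\<bar>"
      have "u \<le> H"
        unfolding u_def H_def using True
        by (intro member_le_sum[where f = "\<lambda>l. \<bar>\<Sum>i<n. a i * sylvester k l i\<bar>"]) auto
      moreover have "u \<le> L"
        unfolding u_def L_def by (rule order_trans[OF sum_abs]) (simp add: abs_mult abs_sylvester)
      ultimately have "(1 + s) * u \<le> H + s * L"
        using \<open>0 \<le> s\<close> by (simp add: distrib_right add_mono mult_left_mono)
      then have "u \<le> (H + s * L) / (1 + s)"
        using \<open>0 \<le> s\<close> by (simp add: pos_le_divide_eq mult.commute)
      then have "u / n \<le> (H + s * L) / (1 + s) / n"
        by (intro divide_right_mono) auto
      then show ?thesis
        using True by (simp add: pairing[OF that] N w_def u_def mult.commute)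
    next
      case False
      define u where "u = \<bar>a (b - n)\<bar>"
      have "n * u \<le> H"
        using sylvester_row_norm_ge[of "b - n" k a] False that by (simp add: u_def H_def n_def)
      moreover have "u \<le> L"
        unfolding u_def L_def using False that
        by (intro member_le_sum[where f = "\<lambda>i. \<bar>a i\<bar>"]) auto
      ultimately have "(n + s) * u \<le> H + s * L"
        using \<open>0 \<le> s\<close> by (simp add: distrib_right add_mono mult_left_mono)
      then have "u \<le> (H + s * L) / (n + s)"
        using \<open>0 \<le> s\<close> n(1) by (simp add: pos_le_divide_eq mult.commute)
      then have "s / n * u \<le> s / n * ((H + s * L) / (n + s))"
        using \<open>0 \<le> s\<close> by (intro mult_left_mono) auto
      then show ?thesis
        using False by (simp add: pairing[OF that] N w_def u_def mult.commute)
    qed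
  qed
  have "(\<Sum>b<n + n. w b) = (\<Sum>b<n. 1 / (1 + s)) + (\<Sum>b<n. s / (n + s))"
    unfolding w_def by (rule sum_two_blocks)
  also have "\<dots> = n * (1 / \<rho>)"
    unfolding s[symmetric] n(2)[symmetric] by (simp add: distrib_left)
  finally have w_sum: "\<rho> * (\<Sum>b<n + n. w b) = n"
    using \<open>0 < \<rho>\<close> by simp
  have w0: "0 \<le> w b" for b
    using \<open>0 \<le> s\<close> by (simp add: w_def)
  note result = projection_constant_annihilator[OF n(1) \<open>0 < \<rho>\<close> dual y_norm w_bound w0 w_sum]
  show "finite_codimensional (annihilator (n + n) n x)"
    by (rule result(1))
  show "projection_constant (annihilator (n + n) n x) = ereal (1 + \<rho>)"
    by (rule result(2))
  show "\<not> projection_constant_attained (annihilator (n + n) n x)"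
    by (rule result(3))
qed

theorem theorem1p2:
  fixes \<Lambda> :: real
  assumes "2 \<le> \<Lambda>"
  shows "\<exists>Y :: C01 set. subspace Y \<and> closed Y \<and> finite_codimensional Y \<and>
    projection_constant Y = ereal \<Lambda> \<and> \<not> projection_constant_attained Y"
proof -
  obtain k where "(2 * \<Lambda>)\<^sup>2 < 2 ^ k"
    using real_arch_pow[of 2 "(2 * \<Lambda>)\<^sup>2"] by auto
  then have "2 * \<Lambda> < sqrt (2 ^ k)"
    by (simp add: real_less_rsqrt)
  then obtain s where s: "0 \<le> s" "1 / (1 + s) + s / (2 ^ k + s) = 1 / (\<Lambda> - 1)"
    using parameter_exists[of "\<Lambda> - 1" "2 ^ k"] assms by auto
  have "0 < \<Lambda> - 1" using assms by simp
  note result = sylvester_projection_constant[OF s(1) this s(2)]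
  show ?thesis
  proof (intro exI conjI)
    show "projection_constant (annihilator (2 ^ k + 2 ^ k) (2 ^ k) (\<lambda>b i. if b < 2 ^ k
        then sylvester k b i / (2 ^ k :: nat) else s / (2 ^ k :: nat) * of_bool (b - 2 ^ k = i))) = ereal \<Lambda>"
      using result(2) by simp
  qed (use result in \<open>simp_all add: subspace_annihilator closed_annihilator\<close>)
qed

end
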